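(* Let $c>0$. The operator $L^{\mathrm{DIF}}$ is self-dual, with duality function given by $$D(x,y)=\prod_{j=1}^N\phi(x_j,y_j;c),\qquad x,y\in\mathbb R^N,$$ i.e. $[L^{\mathrm{DIF}}D(\cdot,y)](x)=[L^{\mathrm{DIF}}D(x,\cdot)](y)$ for all $x,y\in\mathbb R^N$.
   Context: $N$ is a positive integer. $L^{\mathrm{DIF}}$ is the differential operator acting on appropriate complex-valued functions $f$ on $\mathbb R^N$ by $$L^{\mathrm{DIF}}f(x)=\sum_{1\le i<j\le N}\left[c\left(\frac{\partial}{\partial x_i}-\frac{\partial}{\partial x_j}\right)^2f(x)-(x_i-x_j)\left(\frac{\partial}{\partial x_i}-\frac{\partial}{\partial x_j}\right)f(x)\right],\qquad x\in\mathbb R^N.$$ The function $\phi$ is $$\phi(x,y;c)=\exp\left(\frac{x^2+y^2}{4c}-\frac{ixy}{c}\right),\qquad x,y\in\mathbb R.$$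
   Formalization: The mixed term of φ is taken as −ixy/(2c) instead of the printed −ixy/c, because with the printed constant the identity fails for every N ≥ 2 (e.g. N=2, x=(1,0), y=(0,0) gives 1−1/(4c) against 1−1/c, times D). *)

theory Defs
  imports "HOL-Analysis.Analysis"
begin

text \<open>
  \<open>\<real>\<^sup>N\<close> is \<^typ>\<open>real ^ 'n\<close> with \<open>N = CARD('n)\<close>. The linear order on the index type
  serves only to express sums over \<open>i < j\<close>.
\<close>

definition partial :: "'n::finite \<Rightarrow> (real ^ 'n::finite \<Rightarrow> complex) \<Rightarrow> real ^ 'n::finite \<Rightarrow> complex" where
  "partial i f x = vector_derivative (\<lambda>t. f (x + t *\<^sub>R axis i 1)) (at 0)"

definition partial_diff :: "'n::finite \<Rightarrow> 'n::finite \<Rightarrow> (real ^ 'n::finite \<Rightarrow> complex) \<Rightarrow> real ^ 'n::finite \<Rightarrow> complex" where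
  "partial_diff i j f x = partial i f x - partial j f x"

definition L_DIF :: "real \<Rightarrow> (real ^ 'n::{finite,linorder} \<Rightarrow> complex) \<Rightarrow> real ^ 'n::{finite,linorder} \<Rightarrow> complex" where
  "L_DIF c f x =
     (\<Sum>(i, j) | i < j.
        of_real c * partial_diff i j (partial_diff i j f) x
        - of_real (x $ i - x $ j) * partial_diff i j f x)"

text \<open>
  The source prints the mixed term of \<open>\<phi>\<close> as \<open>-\<i>xy/c\<close>. With that constant self-duality fails
  for every \<open>N \<ge> 2\<close>. For \<open>\<phi>(x,y) = exp ((x\<^sup>2 + y\<^sup>2)/(4c) - \<i>bxy)\<close> one finds
  \<open>L D(\<cdot>,y) (x) / D(x,y) = \<Sum>i<j. 1 - (x\<^sub>i - x\<^sub>j)\<^sup>2/(4c) - c b\<^sup>2 (y\<^sub>i - y\<^sub>j)\<^sup>2\<close>,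
  which is symmetric in \<open>x\<close> and \<open>y\<close> only if \<open>b = 1/(2c)\<close> or \<open>b = -1/(2c)\<close>. We therefore use
  \<open>-\<i>xy/(2c)\<close>; this corrects the printed formula.
\<close>

definition phi :: "real \<Rightarrow> real \<Rightarrow> real \<Rightarrow> complex" where
  "phi x y c = exp (of_real ((x\<^sup>2 + y\<^sup>2) / (4 * c)) - \<i> * of_real (x * y / (2 * c)))"

definition D_phi :: "real \<Rightarrow> real ^ 'n::finite \<Rightarrow> real ^ 'n::finite \<Rightarrow> complex" where
  "D_phi c x y = (\<Prod>j\<in>UNIV. phi (x $ j) (y $ j) c)"

definition self_dual_with ::
  "((real ^ 'n::finite \<Rightarrow> complex) \<Rightarrow> real ^ 'n::finite \<Rightarrow> complex) \<Rightarrow> (real ^ 'n::finite \<Rightarrow> real ^ 'n::finite \<Rightarrow> complex) \<Rightarrow> bool" where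
  "self_dual_with L D \<longleftrightarrow> (\<forall>x y. L (\<lambda>x'. D x' y) x = L (\<lambda>y'. D x y') y)"

end

theory Submission
  imports Defs
begin

text \<open>
  Each \<open>\<partial>\<^sub>i - \<partial>\<^sub>j\<close> acts on \<open>D(\<cdot>, y)\<close> as multiplication by
  \<open>u = (X - \<i>Y)/(2c)\<close>, where \<open>X = x\<^sub>i - x\<^sub>j\<close> and \<open>Y = y\<^sub>i - y\<^sub>j\<close>, and \<open>(\<partial>\<^sub>i - \<partial>\<^sub>j) u = 1/c\<close>.
  The \<open>(i,j)\<close> summand is therefore \<open>c(u\<^sup>2 + 1/c) - Xu = 1 - (X\<^sup>2 + Y\<^sup>2)/(4c)\<close> times
  \<open>D(x, y)\<close>, and both factors are symmetric in \<open>x\<close> and \<open>y\<close>.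
\<close>

lemma phi_add:
  assumes "c \<noteq> 0"
  shows "phi (a + t) b c
    = phi a b c * exp (of_real ((2 * a * t + t\<^sup>2) / (4 * c)) - \<i> * of_real (t * b / (2 * c)))"
  unfolding phi_def exp_add [symmetric]
  by (rule arg_cong [where f = exp])
    (use assms in \<open>simp add: complex_eq_iff power2_eq_square field_simps\<close>)

text \<open>A shift along one axis changes a single factor of the product, and the change splits off
  as an exponential. What remains to differentiate is a function of the scalar
  \<open>t\<close>.\<close>

lemma D_phi_add_axis:
  assumes "c \<noteq> 0"
  shows "D_phi c (x + t *\<^sub>R axis i 1) y
    = D_phi c x y * exp (of_real ((2 * x $ i * t + t\<^sup>2) / (4 * c)) - \<i> * of_real (t * y $ i / (2 * c)))"
    (is "_ = _ * ?e")
proof -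
  have "phi ((x + t *\<^sub>R axis i 1) $ j) (y $ j) c
      = phi (x $ j) (y $ j) c * (if j = i then ?e else 1)" for j
    using phi_add [OF assms, of "x $ i" t "y $ i"] by (simp add: axis_def)
  then show ?thesis
    unfolding D_phi_def by (simp add: prod.distrib)
qed

lemma has_vector_derivative_D_phi_axis:
  assumes "c \<noteq> 0"
  shows "((\<lambda>t. D_phi c (x + t *\<^sub>R axis i 1) y) has_vector_derivative
    (of_real (x $ i) - \<i> * of_real (y $ i)) / of_real (2 * c) * D_phi c x y) (at 0)"
proof -
  \<comment> \<open>Extending \<open>t\<close> to a complex \<open>z\<close> makes the field
    derivative rules applicable; restriction to the real line then gives the vector
    derivative.\<close>
  define g where "g z = D_phi c x y *
      exp ((2 * of_real (x $ i) * z + z\<^sup>2) / of_real (4 * c) - \<i> * (z * of_real (y $ i) / of_real (2 * c)))"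
    for z :: complex
  have "(g has_field_derivative
      (of_real (x $ i) - \<i> * of_real (y $ i)) / of_real (2 * c) * D_phi c x y) (at (of_real 0))"
    unfolding g_def using assms
    by (auto intro!: derivative_eq_intros simp: field_simps)
  from has_vector_derivative_real_field [OF this]
  show ?thesis
    unfolding D_phi_add_axis [OF assms] g_def by simp
qed

lemma partial_diff_D_phi:
  assumes "c \<noteq> 0"
  shows "partial_diff i j (\<lambda>x. D_phi c x y) x
    = (of_real (x $ i - x $ j) - \<i> * of_real (y $ i - y $ j)) / of_real (2 * c) * D_phi c x y"
  unfolding partial_diff_def partial_def
    vector_derivative_at [OF has_vector_derivative_D_phi_axis [OF assms]]
  using assms by (simp add: field_simps)

lemma partial_diff_mult_D_phi:
  assumes "c \<noteq> 0" "i \<noteq> j"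
  shows "partial_diff i j
      (\<lambda>x. (of_real (x $ i - x $ j) - \<i> * of_real (y $ i - y $ j)) / of_real (2 * c) * D_phi c x y) x
    = (((of_real (x $ i - x $ j) - \<i> * of_real (y $ i - y $ j)) / of_real (2 * c))\<^sup>2 + 1 / of_real c)
      * D_phi c x y"
proof -
  let ?u = "\<lambda>x. (of_real (x $ i - x $ j) - \<i> * of_real (y $ i - y $ j)) / of_real (2 * c) :: complex"
  let ?w = "\<lambda>k. (of_real (x $ k) - \<i> * of_real (y $ k)) / of_real (2 * c) :: complex"
  \<comment> \<open>A general \<open>k\<close> covers both axes at once: the difference of
    \<open>axis\<close> entries is the slope of \<open>x $ i - x $ j\<close> in direction
    \<open>k\<close>.\<close>
  have partial: "partial k (\<lambda>x. ?u x * D_phi c x y) x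
      = (?u x * ?w k + of_real (axis k 1 $ i - axis k 1 $ j) / of_real (2 * c)) * D_phi c x y" for k
  proof -
    have "((\<lambda>t. of_real ((x + t *\<^sub>R axis k 1) $ i - (x + t *\<^sub>R axis k 1) $ j) :: complex)
        has_vector_derivative of_real (axis k 1 $ i - axis k 1 $ j)) (at 0)"
      by (rule has_vector_derivative_of_real) (auto intro!: derivative_eq_intros)
    then have "((\<lambda>t. ?u (x + t *\<^sub>R axis k 1)) has_vector_derivative
        (of_real (axis k 1 $ i - axis k 1 $ j) - 0) / of_real (2 * c)) (at 0)"
      by (intro has_vector_derivative_divide has_vector_derivative_diff has_vector_derivative_const)
    from has_vector_derivative_mult [OF this has_vector_derivative_D_phi_axis [OF assms(1), of x k y]]
    have "((\<lambda>t. ?u (x + t *\<^sub>R axis k 1) * D_phi c (x + t *\<^sub>R axis k 1) y) has_vector_derivative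
        ?u x * (?w k * D_phi c x y)
        + of_real (axis k 1 $ i - axis k 1 $ j) / of_real (2 * c) * D_phi c x y) (at 0)"
      by simp
    then show ?thesis
      unfolding partial_def by (simp only: vector_derivative_at distrib_right mult.assoc)
  qed
  have u: "?u x = ?w i - ?w j"
    using assms(1) by (simp add: field_simps)
  \<comment> \<open>The slopes \<open>1\<close> and \<open>- 1\<close> for \<open>k = i\<close> and
    \<open>k = j\<close> rely on \<open>i \<noteq> j\<close>; together they produce
    \<open>1 / of_real c\<close>.\<close>
  have algebra: "(v * a + of_real 1 / of_real (2 * c)) * d - (v * b + of_real (- 1) / of_real (2 * c)) * d
      = (v\<^sup>2 + 1 / of_real c) * d" if "v = a - b" for v a b d :: complex
  proof -
    from that have a: "a = v + b" by simp
    show ?thesis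
      using assms(1) unfolding a by (simp add: power2_eq_square field_simps)
  qed
  have "axis i 1 $ i - axis i 1 $ j = (1 :: real)" "axis j 1 $ i - axis j 1 $ j = (- 1 :: real)"
    using assms(2) by (simp_all add: axis_def)
  with algebra [OF u] show ?thesis
    unfolding partial_diff_def partial by (simp only:)
qed

lemma L_DIF_D_phi:
  assumes "c \<noteq> 0"
  shows "L_DIF c (\<lambda>x. D_phi c x y) x
    = (\<Sum>(i, j) | i < j. of_real (1 - ((x $ i - x $ j)\<^sup>2 + (y $ i - y $ j)\<^sup>2) / (4 * c)) * D_phi c x y)"
proof -
  \<comment> \<open>The second-order and drift parts contribute the same mixed term
    \<open>- \<i> * a * b / (2 * c)\<close>, so it cancels and the value is real.\<close>
  have algebra: "of_real c * (((of_real a - \<i> * of_real b) / of_real (2 * c))\<^sup>2 + 1 / of_real c)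
      - of_real a * ((of_real a - \<i> * of_real b) / of_real (2 * c))
      = of_real (1 - (a\<^sup>2 + b\<^sup>2) / (4 * c))" for a b :: real
    using assms by (simp add: complex_eq_iff power2_eq_square field_simps)
  have "of_real c * partial_diff i j (partial_diff i j (\<lambda>x. D_phi c x y)) x
        - of_real (x $ i - x $ j) * partial_diff i j (\<lambda>x. D_phi c x y) x
      = of_real (1 - ((x $ i - x $ j)\<^sup>2 + (y $ i - y $ j)\<^sup>2) / (4 * c)) * D_phi c x y"
    if "i < j" for i j
  proof -
    from that have "i \<noteq> j" by simp
    then show ?thesis
      \<comment> \<open>As an equation of functions (\<open>abs_def\<close>), the first-order
        formula also rewrites the argument of the outer \<open>partial_diff\<close>.\<close>
      unfolding partial_diff_D_phi [OF assms, abs_def] partial_diff_mult_D_phi [OF assms \<open>i \<noteq> j\<close>]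
        algebra [symmetric]
      by (simp only: left_diff_distrib mult.assoc)
  qed
  then show ?thesis
    unfolding L_DIF_def by (intro sum.cong) auto
qed

lemma D_phi_commute: "D_phi c x y = D_phi c y x"
  by (simp add: D_phi_def phi_def add.commute mult.commute)

theorem theorem3p15:
  fixes c :: real
  assumes "0 < c"
  shows "self_dual_with (L_DIF c) (D_phi c :: real ^ 'n::{finite,linorder} \<Rightarrow> real ^ 'n::{finite,linorder} \<Rightarrow> complex)"
  unfolding self_dual_with_def
proof (intro allI)
  fix x y :: "real ^ 'n::{finite,linorder}"
  have c: "c \<noteq> 0" using assms by simp
  show "L_DIF c (\<lambda>x'. D_phi c x' y) x = L_DIF c (\<lambda>y'. D_phi c x y') y"
    \<comment> \<open>Swapping arguments under the right-hand operator lets it act on the first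
      slot, so one formula evaluates both sides.\<close>
    unfolding D_phi_commute [of c x] L_DIF_D_phi [OF c]
    by (simp add: add.commute D_phi_commute [of c x])
qed

end
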